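(* In the social learning model, assume there exist $c>0$, $k>0$ and $x_0>0$ such that $G_-(-x)=c\,x^{-k}$ and $G_+(x)=1-c\,x^{-k}$ for all $x>x_0$. Then $\mathbb{E}(T_L)<\infty$.
   Context: Social learning model. A state $\theta\in\{-1,+1\}$ is drawn with $\mathbb{P}(\theta=+1)=\mathbb{P}(\theta=-1)=1/2$. Agents $t=1,2,\dots$ receive private signals $s_t\in\mathbb{R}$ that are i.i.d. conditionally on $\theta$, with CDF $F_+$ if $\theta=+1$ and $F_-$ if $\theta=-1$; $F_+$ and $F_-$ are mutually absolutely continuous. Let $L_t=\log\frac{\mathbb{P}(\theta=+1\mid s_t)}{\mathbb{P}(\theta=-1\mid s_t)}$ be the private log-likelihood ratio, and let $G_+$, $G_-$ denote the CDFs of $L_t$ conditional on $\theta=+1$, $\theta=-1$ respectively. Signals are assumed unbounded: for every $M\in\mathbb{R}$, $\mathbb{P}(L_t>M)>0$ and $\mathbb{P}(L_t<-M)>0$. Agent $t$ observes $a_1,\dots,a_{t-1}$ and her own signal and chooses $a_t\in\{-1,+1\}$ (utility $1$ if $a_t=\theta$, else $0$). The public belief is $\mu_t=\mathbb{P}(\theta=+1\mid a_1,\dots,a_{t-1})$ and $\ell_t=\log\frac{\mu_t}{1-\mu_t}$ (so $\ell_1=0$). In equilibrium $a_t=+1$ iff $\ell_t+L_t>0$, and otherwise $a_t=-1$. Consequently $\ell_{t+1}=\ell_t+D_+(\ell_t)$ if $a_t=+1$ and $\ell_{t+1}=\ell_t+D_-(\ell_t)$ if $a_t=-1$, where $D_+(x)=\log\frac{1-G_+(-x)}{1-G_-(-x)}$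 and $D_-(x)=\log\frac{G_+(-x)}{G_-(-x)}$. We write $\mathbb{P}_+(\cdot)=\mathbb{P}(\cdot\mid\theta=+1)$ and $\mathbb{E}_+$ for the corresponding expectation. The time to learn is $T_L=\min\{t: a_\tau=\theta\text{ for all }\tau\ge t\}$. *)

theory Defs
  imports "HOL-Probability.Probability"
begin

text \<open>Signals live in the real line. Fp, Fm are the conditional signal
distributions given theta = +1 and theta = -1 (probability measures on borel).\<close>

text \<open>Private log-likelihood ratio of a signal s: with the uniform prior,
log (P(theta=+1|s)/P(theta=-1|s)) = log (dFp/dFm)(s).\<close>
definition privL :: "real measure \<Rightarrow> real measure \<Rightarrow> real \<Rightarrow> real" where
  "privL Fp Fm s = ln (enn2real (RN_deriv Fm Fp s))"

definition Gp :: "real measure \<Rightarrow> real measure \<Rightarrow> real \<Rightarrow> real" where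
  "Gp Fp Fm x = measure Fp {s. privL Fp Fm s \<le> x}"

definition Gm :: "real measure \<Rightarrow> real measure \<Rightarrow> real \<Rightarrow> real" where
  "Gm Fp Fm x = measure Fm {s. privL Fp Fm s \<le> x}"

definition Dp :: "real measure \<Rightarrow> real measure \<Rightarrow> real \<Rightarrow> real" where
  "Dp Fp Fm x = ln ((1 - Gp Fp Fm (- x)) / (1 - Gm Fp Fm (- x)))"

definition Dm :: "real measure \<Rightarrow> real measure \<Rightarrow> real \<Rightarrow> real" where
  "Dm Fp Fm x = ln (Gp Fp Fm (- x) / Gm Fp Fm (- x))"

text \<open>Public log-likelihood ratio ell_t for agents t = 1,2,...; the signal of
agent t is w t (w 0 is unused, and ell 0 is a dummy value).\<close>
primrec ell :: "real measure \<Rightarrow> real measure \<Rightarrow> nat \<Rightarrow> (nat \<Rightarrow> real) \<Rightarrow> real" where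
  "ell Fp Fm 0 w = 0"
| "ell Fp Fm (Suc t) w =
     (if t = 0 then 0
      else (let l = ell Fp Fm t w in
            if l + privL Fp Fm (w t) > 0 then l + Dp Fp Fm l else l + Dm Fp Fm l))"

definition act :: "real measure \<Rightarrow> real measure \<Rightarrow> nat \<Rightarrow> (nat \<Rightarrow> real) \<Rightarrow> int" where
  "act Fp Fm t w = (if ell Fp Fm t w + privL Fp Fm (w t) > 0 then 1 else -1)"

definition TL :: "real measure \<Rightarrow> real measure \<Rightarrow> int \<Rightarrow> (nat \<Rightarrow> real) \<Rightarrow> ennreal" where
  "TL Fp Fm \<theta> w =
     (if \<exists>t\<ge>1. \<forall>\<tau>\<ge>t. act Fp Fm \<tau> w = \<theta>
      then of_nat (LEAST t. t \<ge> 1 \<and> (\<forall>\<tau>\<ge>t. act Fp Fm \<tau> w = \<theta>))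
      else \<infinity>)"

text \<open>Unconditional expectation of T_L: theta = +1 or -1 with probability 1/2,
and, given theta, the signals are i.i.d. with law Fp resp. Fm.\<close>
definition ETL :: "real measure \<Rightarrow> real measure \<Rightarrow> ennreal" where
  "ETL Fp Fm =
     (1/2) * (\<integral>\<^sup>+ w. TL Fp Fm 1 w \<partial>(PiM UNIV (\<lambda>_::nat. Fp)))
   + (1/2) * (\<integral>\<^sup>+ w. TL Fp Fm (-1) w \<partial>(PiM UNIV (\<lambda>_::nat. Fm)))"

end

theory Submission
  imports Defs
begin

text \<open>
  Condition on \<open>\<theta> = 1\<close> (the other state is symmetric). Since \<open>T_L - 1\<close> is the time of the last
  mistake, it is at most the sum of all times at which a mistake occurs. The public log-likelihood
  ratio \<open>\<ell>\<close> is a Markov chain. For \<open>0 < s < 1\<close> one step multiplies \<open>exp (- s \<ell>)\<close> in expectation by a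
  Hellinger-type affinity of the two Bernoulli laws of the current action; by the polynomial tails
  this factor is at most \<open>1 - \<eta> exp (- \<bar>\<ell>\<bar> / 8)\<close>, while a mistake has probability at most
  \<open>exp (- \<ell> / 2)\<close>. Hence \<open>exp (- \<ell>/4) + exp (- 3\<ell>/4)\<close> and \<open>exp (- \<ell>/8) + exp (- 7\<ell>/8)\<close> are, up to constants,
  Lyapunov functions whose drifts absorb the probability of a mistake and the first function,
  respectively, so that the expected sum of the mistake times is finite.
\<close>

subsection \<open>Visit times of Markov chains\<close>

text \<open>The state met by the input \<open>w n\<close> depends only on the inputs before it, so
  under an i.i.d. law of \<open>w\<close> this is a Markov chain started at
  \<open>x\<close>.\<close>

primrec orbit :: "('a \<Rightarrow> 'b \<Rightarrow> 'a) \<Rightarrow> 'a \<Rightarrow> nat \<Rightarrow> (nat \<Rightarrow> 'b) \<Rightarrow> 'a" where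
  "orbit f x 0 w = x"
| "orbit f x (Suc n) w = f (orbit f x n w) (w n)"

text \<open>The recursion of \<open>orbit\<close> appends a last step, whereas the inductions below
  split off the first one.\<close>

lemma orbit_case_nat: "orbit f x (Suc n) (case_nat s w) = orbit f (f x s) n w"
  by (induction n) auto

lemma measurable_orbit:
  assumes f: "(\<lambda>(x, s). f x s) \<in> N \<Otimes>\<^sub>M M \<rightarrow>\<^sub>M N" and x: "x \<in> space N"
  shows "orbit f x n \<in> (\<Pi>\<^sub>M i\<in>(UNIV :: nat set). M) \<rightarrow>\<^sub>M N"
proof (induction n)
  case 0
  then show ?case using x by simp
next
  case (Suc n)
  note [measurable] = Suc
  have "(\<lambda>w. (\<lambda>(x, s). f x s) (orbit f x n w, w n)) \<in> (\<Pi>\<^sub>M i\<in>(UNIV :: nat set). M) \<rightarrow>\<^sub>M N"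
    by (rule measurable_compose[OF _ f]) measurable
  then show ?case by simp
qed

section \<open>Conditioning on the first input of an i.i.d. sequence\<close>

context sequence_space
begin

text \<open>Prepending an independent input to an i.i.d. sequence reproduces its law
  (\<open>PiM_iter\<close>).\<close>

lemma nn_integral_first_step:
  assumes [measurable]: "g \<in> borel_measurable S"
  shows "(\<integral>\<^sup>+ w. g w \<partial>S) = (\<integral>\<^sup>+ s. \<integral>\<^sup>+ w. g (case_nat s w) \<partial>S \<partial>M)"
proof -
  have "(\<integral>\<^sup>+ w. g w \<partial>S) = (\<integral>\<^sup>+ w. g w \<partial>(distr (M \<Otimes>\<^sub>M S) S (\<lambda>(s, w). case_nat s w)))"
    by (simp add: PiM_iter)
  also have "\<dots> = (\<integral>\<^sup>+ z. g (case z of (s, w) \<Rightarrow> case_nat s w) \<partial>(M \<Otimes>\<^sub>M S))"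
    by (rule nn_integral_distr) auto
  also have "\<dots> = (\<integral>\<^sup>+ s. \<integral>\<^sup>+ w. g (case_nat s w) \<partial>S \<partial>M)"
    by (subst P.nn_integral_fst[symmetric]) (auto simp: split_beta')
  finally show ?thesis .
qed

text \<open>Serves the numbering of agents from 1, which leaves \<open>w 0\<close> unread.\<close>

lemma nn_integral_shift:
  assumes [measurable]: "g \<in> borel_measurable S"
  shows "(\<integral>\<^sup>+ w. g (\<lambda>n. w (Suc n)) \<partial>S) = (\<integral>\<^sup>+ w. g w \<partial>S)"
proof -
  have "(\<lambda>w. \<lambda>n. w (Suc n)) \<in> S \<rightarrow>\<^sub>M S"
    by (rule measurable_PiM_single') (auto simp: space_PiM)
  then have "(\<lambda>w. g (\<lambda>n. w (Suc n))) \<in> borel_measurable S"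
    using measurable_compose[OF _ assms] by blast
  then show ?thesis
    by (subst nn_integral_first_step) (simp_all add: M.emeasure_space_1)
qed

text \<open>Iterating the drift inequality for \<open>U\<close> bounds the expected number of visits to \<open>B\<close>; iterating
  the one for \<open>W\<close> on top of it weights each visit by its time.\<close>

context
  fixes f :: "'b \<Rightarrow> 'a \<Rightarrow> 'b" and N :: "'b measure" and B :: "('b \<times> 'a) set" and U W :: "'b \<Rightarrow> ennreal"
  assumes f: "(\<lambda>(x, s). f x s) \<in> N \<Otimes>\<^sub>M M \<rightarrow>\<^sub>M N" and B: "B \<in> sets (N \<Otimes>\<^sub>M M)"
    and U[measurable]: "U \<in> borel_measurable N" and W[measurable]: "W \<in> borel_measurable N"
    and U_drift: "\<And>x. x \<in> space N \<Longrightarrow> (\<integral>\<^sup>+ s. U (f x s) \<partial>M) + (\<integral>\<^sup>+ s. indicator B (x, s) \<partial>M) \<le> U x"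
    and W_drift: "\<And>x. x \<in> space N \<Longrightarrow> (\<integral>\<^sup>+ s. W (f x s) \<partial>M) + U x \<le> W x"
begin

definition visit :: "'b \<Rightarrow> nat \<Rightarrow> (nat \<Rightarrow> 'a) \<Rightarrow> ennreal" where
  "visit x n w = indicator B (orbit f x n w, w n)"

lemma visit_case_nat:
  "visit x 0 (case_nat s w) = indicator B (x, s)"
  "visit x (Suc n) (case_nat s w) = visit (f x s) n w"
  unfolding visit_def orbit_case_nat by simp_all

lemma measurable_visit:
  assumes "x \<in> space N"
  shows "visit x n \<in> borel_measurable S"
proof -
  note [measurable] = measurable_orbit[OF f assms] B
  show ?thesis unfolding visit_def[abs_def] by measurable
qed

lemma measurable_step: "x \<in> space N \<Longrightarrow> f x \<in> M \<rightarrow>\<^sub>M N"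
  using measurable_compose[OF measurable_Pair1' f, of x] by simp

text \<open>The first input decides the visit at time 0; what remains is the chain started at
  \<open>f x s\<close>, so the induction runs over all starting points.\<close>

lemma nn_integral_visits_le:
  assumes "x \<in> space N"
  shows "(\<integral>\<^sup>+ w. (\<Sum>n<K. visit x n w) \<partial>S) \<le> U x"
  using assms
proof (induction K arbitrary: x)
  case 0
  then show ?case by simp
next
  case (Suc K)
  note x = \<open>x \<in> space N\<close>
  note [measurable] = B measurable_visit measurable_step[OF x]
  have fx: "f x s \<in> space N" if "s \<in> space M" for s
    using measurable_space[OF measurable_step[OF x] that] .
  have "(\<integral>\<^sup>+ w. (\<Sum>n<Suc K. visit x n w) \<partial>S)
      = (\<integral>\<^sup>+ s. \<integral>\<^sup>+ w. (\<Sum>n<Suc K. visit x n (case_nat s w)) \<partial>S \<partial>M)"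
    using x by (intro nn_integral_first_step borel_measurable_sum measurable_visit)
  also have "\<dots> = (\<integral>\<^sup>+ s. \<integral>\<^sup>+ w. indicator B (x, s) + (\<Sum>n<K. visit (f x s) n w) \<partial>S \<partial>M)"
    by (simp add: sum.lessThan_Suc_shift visit_case_nat del: sum.lessThan_Suc)
  also have "\<dots> = (\<integral>\<^sup>+ s. indicator B (x, s) + (\<integral>\<^sup>+ w. (\<Sum>n<K. visit (f x s) n w) \<partial>S) \<partial>M)"
    by (intro nn_integral_cong, subst nn_integral_add) (auto simp: fx P.emeasure_space_1)
  also have "\<dots> \<le> (\<integral>\<^sup>+ s. indicator B (x, s) + U (f x s) \<partial>M)"
    by (intro nn_integral_mono add_left_mono Suc.IH fx)
  also have "\<dots> = (\<integral>\<^sup>+ s. indicator B (x, s) \<partial>M) + (\<integral>\<^sup>+ s. U (f x s) \<partial>M)"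
    using measurable_step[OF x] x by (intro nn_integral_add) measurable
  also have "\<dots> \<le> U x"
    using U_drift[OF x] by (simp add: add.commute)
  finally show ?case .
qed

lemma nn_integral_visit_times_le:
  assumes "x \<in> space N"
  shows "(\<integral>\<^sup>+ w. (\<Sum>n<K. of_nat (Suc n) * visit x n w) \<partial>S) \<le> W x"
  using assms
proof (induction K arbitrary: x)
  case 0
  then show ?case by simp
next
  case (Suc K)
  note x = \<open>x \<in> space N\<close>
  note [measurable] = measurable_visit[OF x] measurable_step[OF x]
  have fx: "f x s \<in> space N" if "s \<in> space M" for s
    using measurable_space[OF measurable_step[OF x] that] .
  \<comment> \<open>Summation by parts: of the weight n + 1 of a visit at time n, one unit goes to
    the plain count, bounded by \<open>U\<close>, and n units are its weight in the chain restarted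
    after one step.\<close>
  have "(\<Sum>n<Suc K. of_nat (Suc n) * visit x n w)
      = (\<Sum>n<Suc K. visit x n w) + (\<Sum>n<K. of_nat (Suc n) * visit x (Suc n) w)" for w
    by (simp add: sum.lessThan_Suc_shift sum.distrib algebra_simps del: sum.lessThan_Suc)
  then have "(\<integral>\<^sup>+ w. (\<Sum>n<Suc K. of_nat (Suc n) * visit x n w) \<partial>S)
      = (\<integral>\<^sup>+ w. (\<Sum>n<Suc K. visit x n w) \<partial>S)
        + (\<integral>\<^sup>+ w. (\<Sum>n<K. of_nat (Suc n) * visit x (Suc n) w) \<partial>S)"
    by (simp only:, intro nn_integral_add) measurable
  also have "\<dots> \<le> U x + (\<integral>\<^sup>+ w. (\<Sum>n<K. of_nat (Suc n) * visit x (Suc n) w) \<partial>S)"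
    by (intro add_right_mono nn_integral_visits_le x)
  also have "(\<integral>\<^sup>+ w. (\<Sum>n<K. of_nat (Suc n) * visit x (Suc n) w) \<partial>S)
      = (\<integral>\<^sup>+ s. \<integral>\<^sup>+ w. (\<Sum>n<K. of_nat (Suc n) * visit (f x s) n w) \<partial>S \<partial>M)"
    by (subst nn_integral_first_step) (simp_all add: visit_case_nat)
  also have "U x + \<dots> \<le> U x + (\<integral>\<^sup>+ s. W (f x s) \<partial>M)"
    by (intro add_left_mono nn_integral_mono Suc.IH fx)
  also have "\<dots> \<le> W x"
    using W_drift[OF x] by (simp add: add.commute)
  finally show ?case .
qed

lemma nn_integral_suminf_visit_times_le:
  assumes "x \<in> space N"
  shows "(\<integral>\<^sup>+ w. (\<Sum>n. of_nat (Suc n) * indicator B (orbit f x n w, w n)) \<partial>S) \<le> W x"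
proof -
  note [measurable] = measurable_visit[OF assms]
  have "(\<integral>\<^sup>+ w. (\<Sum>n. of_nat (Suc n) * visit x n w) \<partial>S)
      = (\<Sum>n. \<integral>\<^sup>+ w. of_nat (Suc n) * visit x n w \<partial>S)"
    by (rule nn_integral_suminf) measurable
  also have "\<dots> \<le> W x"
    using nn_integral_visit_times_le[OF assms]
    by (intro suminf_le_const) (auto simp: nn_integral_sum)
  finally show ?thesis unfolding visit_def .
qed

end

end

subsection \<open>Affinities of Bernoulli laws\<close>

text \<open>The Hellinger-type affinity of order \<open>s\<close> of two Bernoulli laws is bounded by interpolating,
  in \<open>s\<close>, between the orders 0, 1/2 and 1.\<close>

lemma powr_le_interpolate_half:
  fixes a s :: real
  assumes a: "a > 0" and s: "0 \<le> s" "s \<le> 1"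
  shows "a powr s \<le> (1 - 2 * min s (1 - s)) * (if s \<le> 1/2 then 1 else a)
                    + 2 * min s (1 - s) * sqrt a"
proof -
  have conv: "convex_on UNIV (exp :: real \<Rightarrow> real)" by (rule exp_convex)
  have sq: "sqrt a = exp (ln a / 2)"
    using a by (simp flip: ln_sqrt)
  show ?thesis
  proof (cases "s \<le> 1/2")
    case True
    \<comment> \<open>Here \<open>s * ln a\<close> is the convex combination of 0 and
      \<open>ln a / 2\<close> with weight \<open>2 * s\<close> on the latter; in the other case the
      endpoints are \<open>ln a\<close> and \<open>ln a / 2\<close>.\<close>
    have "exp ((1 - 2 * s) *\<^sub>R 0 + (2 * s) *\<^sub>R (ln a / 2))
        \<le> (1 - 2 * s) * exp 0 + 2 * s * exp (ln a / 2)"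
      using True s by (intro convex_onD[OF conv]) auto
    then show ?thesis using True a sq by (simp add: powr_def)
  next
    case False
    have "exp ((1 - (2 - 2 * s)) *\<^sub>R ln a + (2 - 2 * s) *\<^sub>R (ln a / 2))
        \<le> (1 - (2 - 2 * s)) * exp (ln a) + (2 - 2 * s) * exp (ln a / 2)"
      using False s by (intro convex_onD[OF conv]) auto
    moreover have "(1 - (2 - 2 * s)) *\<^sub>R ln a + (2 - 2 * s) *\<^sub>R (ln a / 2) = s * ln a"
      by (simp add: algebra_simps)
    ultimately show ?thesis using False a sq by (simp add: powr_def min_def)
  qed
qed

text \<open>The left side is sqrt (p q) + sqrt ((1 - p) (1 - q)), which is one minus half the sum of
  two squared differences of square roots. The second square is dropped; the first is at least (p -
  q)^2 / 4, as sqrt p + sqrt q is at most 2.\<close>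

lemma bernoulli_affinity_half_le:
  fixes p q :: real
  assumes "0 < p" "p < 1" "0 < q" "q < 1"
  shows "p * sqrt (q / p) + (1 - p) * sqrt ((1 - q) / (1 - p)) \<le> 1 - (p - q)\<^sup>2 / 8"
proof -
  have *: "a * sqrt (b / a) = sqrt a * sqrt b" if "a > 0" for a b :: real
    using that by (simp add: real_sqrt_divide) (metis real_div_sqrt less_imp_le mult.commute times_divide_eq_right)
  have "(sqrt p - sqrt q)\<^sup>2 \<ge> (p - q)\<^sup>2 / 4"
  proof -
    have "(p - q)\<^sup>2 = (sqrt p - sqrt q)\<^sup>2 * (sqrt p + sqrt q)\<^sup>2"
    proof -
      have "(sqrt p - sqrt q) * (sqrt p + sqrt q) = p - q"
        using assms by (simp add: algebra_simps)
      then show ?thesis by (metis power_mult_distrib)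
    qed
    also have "\<dots> \<le> (sqrt p - sqrt q)\<^sup>2 * 2\<^sup>2"
    proof -
      have "sqrt p \<le> 1" "sqrt q \<le> 1" using assms by simp_all
      then have "sqrt p + sqrt q \<le> 2" by linarith
      then show ?thesis using assms by (intro mult_left_mono power_mono) auto
    qed
    finally show ?thesis by simp
  qed
  moreover have "(sqrt p - sqrt q)\<^sup>2 = p + q - 2 * (sqrt p * sqrt q)"
    using assms by (simp add: power2_diff)
  moreover have "0 \<le> (sqrt (1 - p) - sqrt (1 - q))\<^sup>2" by simp
  moreover have "(sqrt (1 - p) - sqrt (1 - q))\<^sup>2 = 1 - p + (1 - q) - 2 * (sqrt (1 - p) * sqrt (1 - q))"
    using assms by (simp add: power2_diff)
  ultimately show ?thesis using assms by (simp add: *)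
qed

text \<open>At orders 0 and 1 the affinity equals 1, so the loss comes from the weight
  \<open>m\<close> of order 1/2 in the interpolation; the range of \<open>s\<close> makes this
  weight at least 1/4.\<close>

lemma bernoulli_affinity_le:
  fixes p q s :: real
  assumes pq: "0 < p" "p < 1" "0 < q" "q < 1" and s: "1/8 \<le> s" "s \<le> 7/8"
  shows "p * (q / p) powr s + (1 - p) * ((1 - q) / (1 - p)) powr s \<le> 1 - (p - q)\<^sup>2 / 32"
proof -
  define m where "m = 2 * min s (1 - s)"
  have m: "1/4 \<le> m" "m \<le> 1" using s by (auto simp: m_def min_def)
  let ?e = "\<lambda>a::real. if s \<le> 1/2 then 1 else a"
  have "p * (q / p) powr s + (1 - p) * ((1 - q) / (1 - p)) powr s
     \<le> p * ((1 - m) * ?e (q / p) + m * sqrt (q / p))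
       + (1 - p) * ((1 - m) * ?e ((1 - q) / (1 - p)) + m * sqrt ((1 - q) / (1 - p)))"
    unfolding m_def using pq s
    by (intro add_mono mult_left_mono powr_le_interpolate_half) auto
  also have "\<dots> = (1 - m) * (p * ?e (q / p) + (1 - p) * ?e ((1 - q) / (1 - p)))
      + m * (p * sqrt (q / p) + (1 - p) * sqrt ((1 - q) / (1 - p)))"
    by (simp add: algebra_simps)
  also have "p * ?e (q / p) + (1 - p) * ?e ((1 - q) / (1 - p)) = 1"
    using pq by simp
  also have "(1 - m) * 1 + m * (p * sqrt (q / p) + (1 - p) * sqrt ((1 - q) / (1 - p)))
      \<le> (1 - m) * 1 + m * (1 - (p - q)\<^sup>2 / 8)"
    using m pq by (intro add_left_mono mult_left_mono bernoulli_affinity_half_le) auto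
  also have "\<dots> = 1 - m * ((p - q)\<^sup>2 / 8)" by (simp add: algebra_simps)
  also have "\<dots> \<le> 1 - 1/4 * ((p - q)\<^sup>2 / 8)"
    using m by (intro diff_left_mono mult_right_mono) auto
  finally show ?thesis by simp
qed

text \<open>The factor \<open>exp (\<bar>y\<bar> / 8)\<close> shifts the exponent by 1/8 in a
  direction given by the sign of \<open>y\<close>. Each sum on the right therefore has one
  exponential for each sign.\<close>

lemma exp_le_exp_abs_interpolate:
  fixes y :: real
  shows "exp (\<bar>y\<bar> / 8) * exp (- y / 2) \<le> exp (- y / 4) + exp (- 3 * y / 4)" (is ?A)
    and "exp (\<bar>y\<bar> / 8) * (exp (- y / 4) + exp (- 3 * y / 4)) \<le> 2 * (exp (- y / 8) + exp (- 7 * y / 8))" (is ?B)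
proof -
  have pos: "exp a > 0" for a :: real by simp
  show ?A
  proof (cases "y \<ge> 0")
    case True
    then have "exp (\<bar>y\<bar> / 8) * exp (- y / 2) \<le> exp (- y / 4)" by (simp flip: exp_add)
    then show ?thesis using pos[of "- 3 * y / 4"] by linarith
  next
    case False
    then have "exp (\<bar>y\<bar> / 8) * exp (- y / 2) \<le> exp (- 3 * y / 4)" by (simp flip: exp_add)
    then show ?thesis using pos[of "- y / 4"] by linarith
  qed
  show ?B
  proof (cases "y \<ge> 0")
    case True
    then have "exp (\<bar>y\<bar> / 8) * exp (- y / 4) \<le> exp (- y / 8)"
      "exp (\<bar>y\<bar> / 8) * exp (- 3 * y / 4) \<le> exp (- y / 8)" by (simp_all flip: exp_add)
    then show ?thesis using pos[of "- 7 * y / 8"] unfolding distrib_left by linarith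
  next
    case False
    then have "exp (\<bar>y\<bar> / 8) * exp (- y / 4) \<le> exp (- 7 * y / 8)"
      "exp (\<bar>y\<bar> / 8) * exp (- 3 * y / 4) \<le> exp (- 7 * y / 8)" by (simp_all flip: exp_add)
    then show ?thesis using pos[of "- y / 8"] unfolding distrib_left by linarith
  qed
qed

text \<open>The witness comes from \<open>ln z \<le> z - 1\<close> at z = e x / k; it is the best
  constant, attained at x = k / e.\<close>

lemma powr_minus_ge_exp_minus:
  fixes k e :: real
  assumes "k > 0" "e > 0"
  shows "\<exists>C>0. \<forall>x>0. C * exp (- e * x) \<le> x powr (- k)"
proof (intro exI conjI allI impI)
  show "exp (k * (1 + ln (e / k))) > 0" by simp
  fix x :: real assume x: "x > 0"
  have "ln (e / k * x) \<le> e / k * x - 1"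
    using assms x by (intro ln_le_minus_one) auto
  then have "k * ln (e / k * x) \<le> k * (e / k * x - 1)"
    using assms by (intro mult_left_mono) auto
  moreover have "ln (e / k * x) = ln (e / k) + ln x"
    using assms x by (intro ln_mult_pos) auto
  ultimately have "k * (ln (e / k) + ln x) \<le> e * x - k"
    using assms by (simp add: right_diff_distrib)
  then have "k * (1 + ln (e / k)) + - e * x \<le> - k * ln x"
    by (simp add: algebra_simps)
  then show "exp (k * (1 + ln (e / k))) * exp (- e * x) \<le> x powr (- k)"
    using x by (simp add: powr_def flip: exp_add)
qed

subsection \<open>The distributions of the private log-likelihood ratio\<close>

locale binary_signal =
  pos: prob_space Fp + neg: prob_space Fm for Fp Fm :: "real measure" +
  assumes sets_Fp: "sets Fp = sets borel" and sets_Fm: "sets Fm = sets borel"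
    and ac_pm: "absolutely_continuous Fp Fm" and ac_mp: "absolutely_continuous Fm Fp"
begin

section \<open>Change of measure between the two signal laws\<close>

abbreviation "L \<equiv> privL Fp Fm"

lemma measurable_privL [measurable]: "L \<in> borel_measurable borel"
proof -
  have "RN_deriv Fm Fp \<in> borel_measurable borel"
    using borel_measurable_RN_deriv[of Fm Fp] measurable_cong_sets[OF sets_Fm refl] by blast
  note [measurable] = this
  show ?thesis unfolding privL_def[abs_def] by measurable
qed

lemma space_signal [simp]: "space Fp = UNIV" "space Fm = UNIV"
  using sets_eq_imp_space_eq[OF sets_Fp] sets_eq_imp_space_eq[OF sets_Fm] by auto

lemma level_sets [simp]: "{s. L s \<le> x} \<in> sets borel" "{s. L s > x} \<in> sets borel"
  by measurable

text \<open>The default values of \<open>ln\<close> and \<open>enn2real\<close> interfere only where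
  the density is 0 or infinite. Its zero set is null for \<open>Fp\<close>, hence for
  \<open>Fm\<close> by mutual absolute continuity; it is finite almost everywhere because
  \<open>Fp\<close> is sigma-finite.\<close>

lemma RN_deriv_eq_exp_privL: "AE s in Fm. RN_deriv Fm Fp s = ennreal (exp (L s))"
proof -
  let ?h = "RN_deriv Fm Fp"
  have sets: "sets Fp = sets Fm" by (simp add: sets_Fp sets_Fm)
  have dens: "density Fm ?h = Fp"
    using ac_mp sets by (rule neg.density_RN_deriv)
  have Z: "{s. ?h s = 0} \<in> sets Fm"
    using measurable_sets[OF borel_measurable_RN_deriv[of Fm Fp], of "{0}"] by (simp add: vimage_def)
  have "emeasure Fp {s. ?h s = 0} = (\<integral>\<^sup>+ s. ?h s * indicator {s. ?h s = 0} s \<partial>Fm)"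
    using emeasure_density[OF borel_measurable_RN_deriv Z, of Fp] dens by simp
  also have "\<dots> = (\<integral>\<^sup>+ s. 0 \<partial>Fm)"
    by (intro nn_integral_cong) (auto simp: indicator_def)
  finally have "{s. ?h s = 0} \<in> null_sets Fp" using Z sets by auto
  then have "{s. ?h s = 0} \<in> null_sets Fm"
    using ac_pm by (auto simp: absolutely_continuous_def)
  then have "AE s in Fm. ?h s \<noteq> 0" by (auto dest: AE_not_in)
  moreover have "AE s in Fm. ?h s \<noteq> \<infinity>"
    using pos.sigma_finite_measure_axioms ac_mp sets by (rule neg.RN_deriv_finite)
  ultimately show ?thesis
  proof eventually_elim
    case (elim s)
    then have "enn2real (?h s) > 0" by (simp add: enn2real_positive_iff less_top zero_less_iff_neq_zero)
    then show ?case using elim by (simp add: privL_def ennreal_enn2real less_top)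
  qed
qed

lemma emeasure_Fp:
  assumes "A \<in> sets borel"
  shows "emeasure Fp A = (\<integral>\<^sup>+ s. ennreal (exp (L s)) * indicator A s \<partial>Fm)"
proof -
  have "density Fm (RN_deriv Fm Fp) = Fp"
    using ac_mp by (rule neg.density_RN_deriv) (simp add: sets_Fp sets_Fm)
  then have "emeasure Fp A = (\<integral>\<^sup>+ s. RN_deriv Fm Fp s * indicator A s \<partial>Fm)"
    using emeasure_density[OF borel_measurable_RN_deriv, of A Fm Fp] assms by (simp add: sets_Fm)
  also have "\<dots> = (\<integral>\<^sup>+ s. ennreal (exp (L s)) * indicator A s \<partial>Fm)"
    using RN_deriv_eq_exp_privL by (intro nn_integral_cong_AE) auto
  finally show ?thesis .
qed

text \<open>On \<open>A\<close> the density \<open>exp (L s)\<close> of \<open>Fp\<close> with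
  respect to \<open>Fm\<close> is at most \<open>exp y\<close>.\<close>

lemma measure_Fp_le:
  assumes A: "A \<in> sets borel" and le: "\<And>s. s \<in> A \<Longrightarrow> L s \<le> y"
  shows "measure Fp A \<le> exp y * measure Fm A"
proof -
  have "emeasure Fp A \<le> (\<integral>\<^sup>+ s. ennreal (exp y) * indicator A s \<partial>Fm)"
    unfolding emeasure_Fp[OF A] using le
    by (intro nn_integral_mono) (auto simp: indicator_def intro!: ennreal_leI)
  also have "\<dots> = ennreal (exp y) * emeasure Fm A"
    using A by (intro nn_integral_cmult_indicator) (simp add: sets_Fm)
  finally show ?thesis
    by (simp add: pos.emeasure_eq_measure neg.emeasure_eq_measure flip: ennreal_mult)
qed

lemma measure_Fp_ge:
  assumes A: "A \<in> sets borel" and ge: "\<And>s. s \<in> A \<Longrightarrow> y \<le> L s"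
  shows "exp y * measure Fm A \<le> measure Fp A"
proof -
  have "ennreal (exp y) * emeasure Fm A = (\<integral>\<^sup>+ s. ennreal (exp y) * indicator A s \<partial>Fm)"
    using A by (intro nn_integral_cmult_indicator[symmetric]) (simp add: sets_Fm)
  also have "\<dots> \<le> emeasure Fp A"
    unfolding emeasure_Fp[OF A] using ge
    by (intro nn_integral_mono) (auto simp: indicator_def intro!: ennreal_leI)
  finally show ?thesis
    by (simp add: pos.emeasure_eq_measure neg.emeasure_eq_measure flip: ennreal_mult)
qed

section \<open>Tails of the two distribution functions and the gap between them\<close>

lemma Gp_compl: "1 - Gp Fp Fm y = measure Fp {s. L s > y}"
proof -
  have "UNIV - {s. L s \<le> y} = {s. L s > y}" by auto
  then show ?thesis using pos.prob_compl[of "{s. L s \<le> y}"] by (simp add: Gp_def sets_Fp)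
qed

lemma Gm_compl: "1 - Gm Fp Fm y = measure Fm {s. L s > y}"
proof -
  have "UNIV - {s. L s \<le> y} = {s. L s > y}" by auto
  then show ?thesis using neg.prob_compl[of "{s. L s \<le> y}"] by (simp add: Gm_def sets_Fm)
qed

lemma Gp_le: "Gp Fp Fm y \<le> exp y * Gm Fp Fm y"
  unfolding Gp_def Gm_def by (intro measure_Fp_le) auto

lemma Gm_compl_le: "1 - Gm Fp Fm y \<le> exp (- y) * (1 - Gp Fp Fm y)"
proof -
  have "exp (- y) * (exp y * (1 - Gm Fp Fm y)) \<le> exp (- y) * (1 - Gp Fp Fm y)"
    unfolding Gp_compl Gm_compl by (intro mult_left_mono measure_Fp_ge) auto
  then show ?thesis by (simp flip: mult.assoc exp_add)
qed

lemma G_Icc: "Gp Fp Fm y \<in> {0..1}" "Gm Fp Fm y \<in> {0..1}"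
  by (auto simp: Gp_def Gm_def)

lemma mono_G: "mono (Gp Fp Fm)" "mono (Gm Fp Fm)"
  unfolding Gp_def Gm_def
  by (auto intro!: monoI pos.finite_measure_mono neg.finite_measure_mono simp: sets_Fp sets_Fm)

lemma G_diff:
  assumes "a \<le> b"
  shows "Gp Fp Fm b - Gp Fp Fm a = measure Fp {s. a < L s \<and> L s \<le> b}"
    and "Gm Fp Fm b - Gm Fp Fm a = measure Fm {s. a < L s \<and> L s \<le> b}"
proof -
  have *: "{s. a < L s \<and> L s \<le> b} = {s. L s \<le> b} - {s. L s \<le> a}" by auto
  have "{s. L s \<le> a} \<subseteq> {s. L s \<le> b}" using assms by auto
  then show "Gp Fp Fm b - Gp Fp Fm a = measure Fp {s. a < L s \<and> L s \<le> b}"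
    and "Gm Fp Fm b - Gm Fp Fm a = measure Fm {s. a < L s \<and> L s \<le> b}"
    unfolding * by (simp_all add: pos.finite_measure_Diff neg.finite_measure_Diff sets_Fp sets_Fm Gp_def Gm_def)
qed

text \<open>Where \<open>L s \<le> 0\<close> the density is at most 1, so the event that
  \<open>L\<close> lies in (a, b] is at least as likely under \<open>Fm\<close> as under
  \<open>Fp\<close>. Together with the next lemma: the gap rises up to 0 and falls
  afterwards.\<close>

lemma G_gap_mono:
  assumes "a \<le> b" "b \<le> 0"
  shows "Gm Fp Fm a - Gp Fp Fm a \<le> Gm Fp Fm b - Gp Fp Fm b"
proof -
  have "measure Fp {s. a < L s \<and> L s \<le> b} \<le> exp 0 * measure Fm {s. a < L s \<and> L s \<le> b}"
    using assms by (intro measure_Fp_le) auto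
  then show ?thesis using G_diff[OF \<open>a \<le> b\<close>] by simp
qed

lemma G_gap_antimono:
  assumes "0 \<le> a" "a \<le> b"
  shows "Gm Fp Fm b - Gp Fp Fm b \<le> Gm Fp Fm a - Gp Fp Fm a"
proof -
  have "exp 0 * measure Fm {s. a < L s \<and> L s \<le> b} \<le> measure Fp {s. a < L s \<and> L s \<le> b}"
    using assms by (intro measure_Fp_ge) auto
  then show ?thesis using G_diff[OF \<open>a \<le> b\<close>] by simp
qed

text \<open>The polynomial tails enter the argument only through this bound.\<close>

lemma G_gap_lower_bound:
  assumes pos: "c > 0" "k > 0" "e > 0" and x0: "x0 > 0"
    and tail: "\<And>x. x > x0 \<Longrightarrow> Gm Fp Fm (- x) = c * x powr (- k) \<and> Gp Fp Fm x = 1 - c * x powr (- k)"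
  shows "\<exists>K>0. \<forall>y. K * exp (- e * \<bar>y\<bar>) \<le> Gm Fp Fm y - Gp Fp Fm y"
proof -
  obtain C where C: "C > 0" "\<And>x. x > 0 \<Longrightarrow> C * exp (- e * x) \<le> x powr (- k)"
    using powr_minus_ge_exp_minus pos by blast
  have half: "exp (- x) \<le> 1/2" if "x \<ge> 1" for x :: real
  proof -
    have "2 \<le> exp x" using exp_ge_add_one_self[of x] that by linarith
    then show ?thesis by (simp add: exp_minus field_simps)
  qed
  \<comment> \<open>Exceeds \<open>x0\<close>, so that the tail formulas apply, and 1, so that
    \<open>half\<close> does.\<close>
  define a where "a = x0 + 1"
  let ?D = "\<lambda>y. Gm Fp Fm y - Gp Fp Fm y"
  \<comment> \<open>By \<open>Gp_le\<close> and \<open>Gm_compl_le\<close> the lighter of the two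
    tails is at most \<open>exp (- x)\<close>, hence at most half, of the heavier one; the gap keeps
    half of the polynomial tail.\<close>
  have far: "c / 2 * C * exp (- e * x) \<le> ?D (- x)" "c / 2 * C * exp (- e * x) \<le> ?D x" if "x \<ge> a" for x
  proof -
    have x: "x > x0" "x \<ge> 1" "x > 0" using that x0 by (auto simp: a_def)
    have eq: "Gm Fp Fm (- x) = c * x powr (- k)" "Gp Fp Fm x = 1 - c * x powr (- k)"
      using tail[OF x(1)] by auto
    have t: "c * (C * exp (- e * x)) \<le> c * x powr (- k)"
      using C(2)[OF x(3)] pos by (intro mult_left_mono) auto
    have h: "exp (- x) * (c * x powr (- k)) \<le> 1/2 * (c * x powr (- k))"
      using half[OF x(2)] pos by (intro mult_right_mono) auto
    show "c / 2 * C * exp (- e * x) \<le> ?D (- x)"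
      using Gp_le[of "- x"] t h unfolding eq by simp
    show "c / 2 * C * exp (- e * x) \<le> ?D x"
      using Gm_compl_le[of x] t h unfolding eq by simp
  qed
  \<comment> \<open>The bound \<open>far\<close> at distance \<open>a\<close>. Closer to 0,
    unimodality of the gap carries the value at \<open>a\<close> or \<open>- a\<close>
    inward.\<close>
  define K where "K = c / 2 * C * exp (- e * a)"
  have K: "K > 0" using pos C by (simp add: K_def)
  have "K * exp (- e * \<bar>y\<bar>) \<le> ?D y" for y
  proof (cases "\<bar>y\<bar> \<ge> a")
    case True
    have "exp (- e * a) \<le> 1" using pos x0 by (simp add: a_def)
    then have "K * exp (- e * \<bar>y\<bar>) \<le> c / 2 * C * exp (- e * \<bar>y\<bar>)"
      unfolding K_def using pos C by (intro mult_right_mono mult_left_le) auto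
    also have "\<dots> \<le> ?D y"
      using far[OF True] by (cases "y \<ge> 0") auto
    finally show ?thesis .
  next
    case False
    have "K * exp (- e * \<bar>y\<bar>) \<le> K" using K pos by (intro mult_left_le) auto
    also have "K \<le> ?D y"
    proof (cases "y \<ge> 0")
      case True
      have "K \<le> ?D a" using far(2)[of a] by (simp add: K_def)
      also have "\<dots> \<le> ?D y" using True False by (intro G_gap_antimono) auto
      finally show ?thesis .
    next
      case neg: False
      have "K \<le> ?D (- a)" using far(1)[of a] by (simp add: K_def)
      also have "\<dots> \<le> ?D y" using neg False by (intro G_gap_mono) auto
      finally show ?thesis .
    qed
    finally show ?thesis .
  qed
  with K show ?thesis by blast
qed

text \<open>The strict gap gives \<open>Gm\<close> positive and \<open>Gp\<close> below 1; mutual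
  absolute continuity transfers this to the other law. The quotients and logarithms in
  \<open>Dp\<close> and \<open>Dm\<close> are then genuine.\<close>

lemma G_pos_less_one:
  assumes "\<And>y. Gp Fp Fm y < Gm Fp Fm y"
  shows "0 < Gp Fp Fm y" "Gp Fp Fm y < 1" "0 < Gm Fp Fm y" "Gm Fp Fm y < 1"
proof -
  have mp: "0 < measure Fm A" if "0 < measure Fp A" "A \<in> sets borel" for A
  proof (rule ccontr)
    assume "\<not> 0 < measure Fm A"
    then have "A \<in> null_sets Fm"
      using that by (simp add: null_sets_def neg.emeasure_eq_measure sets_Fm not_less measure_le_0_iff)
    then have "A \<in> null_sets Fp" using ac_mp by (auto simp: absolutely_continuous_def)
    then show False using that by (simp add: null_sets_def pos.emeasure_eq_measure)
  qed
  have pm: "0 < measure Fp A" if "0 < measure Fm A" "A \<in> sets borel" for A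
  proof (rule ccontr)
    assume "\<not> 0 < measure Fp A"
    then have "A \<in> null_sets Fp"
      using that by (simp add: null_sets_def pos.emeasure_eq_measure sets_Fp not_less measure_le_0_iff)
    then have "A \<in> null_sets Fm" using ac_pm by (auto simp: absolutely_continuous_def)
    then show False using that by (simp add: null_sets_def neg.emeasure_eq_measure)
  qed
  have gap: "Gp Fp Fm y < Gm Fp Fm y" by fact
  show "0 < Gm Fp Fm y" "Gp Fp Fm y < 1" using gap G_Icc[of y] by auto
  then show "0 < Gp Fp Fm y" unfolding Gp_def Gm_def by (intro pm) auto
  have "0 < 1 - Gm Fp Fm y" using \<open>Gp Fp Fm y < 1\<close>
    unfolding Gm_compl by (intro mp) (auto simp flip: Gp_compl)
  then show "Gm Fp Fm y < 1" by simp
qed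

lemma measurable_G [measurable]: "Gp Fp Fm \<in> borel_measurable borel" "Gm Fp Fm \<in> borel_measurable borel"
  by (auto intro: borel_measurable_mono mono_G)

end

subsection \<open>Expected time to learn\<close>

text \<open>Read \<open>\<sigma>\<close> as the true state and \<open>p\<close>, \<open>q\<close> as
  the probabilities of action +1 under the true and the false state. Then
  \<open>\<sigma> * x\<close> is the log-likelihood ratio in favour of the truth, and one step
  multiplies the mean of \<open>exp (- a * (\<sigma> * x))\<close> by the affinity of order
  \<open>a\<close>.\<close>

lemma drift_exp_le:
  fixes p q h \<sigma> a b x K :: real
  assumes pq: "0 < p" "p < 1" "0 < q" "q < 1" and \<sigma>: "\<bar>\<sigma>\<bar> = 1" and K: "0 \<le> K"
    and ab: "1/8 \<le> a" "a \<le> 7/8" "1/8 \<le> b" "b \<le> 7/8" and h: "h \<le> (p - q)\<^sup>2 / 32"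
  defines "u \<equiv> x + \<sigma> * ln (p / q)" and "d \<equiv> x + \<sigma> * ln ((1 - p) / (1 - q))"
    and "V \<equiv> \<lambda>y. K * (exp (- a * (\<sigma> * y)) + exp (- b * (\<sigma> * y)))"
  shows "p * V u + (1 - p) * V d \<le> (1 - h) * V x"
proof -
  have \<sigma>2: "\<sigma> * \<sigma> = 1" using \<sigma> by (metis abs_mult_self mult_1)
  have e: "exp (- a * (\<sigma> * (x + \<sigma> * ln (p / q)))) = exp (- a * (\<sigma> * x)) * (q / p) powr a"
    if "p > 0" "q > 0" for a p q :: real
  proof -
    have "- a * (\<sigma> * (x + \<sigma> * ln (p / q))) = - a * (\<sigma> * x) + a * ln (q / p) * (\<sigma> * \<sigma>)"
      using that by (simp add: ln_div algebra_simps)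
    then show ?thesis using that \<sigma>2 by (simp add: powr_def flip: exp_add)
  qed
  have one: "p * exp (- a * (\<sigma> * u)) + (1 - p) * exp (- a * (\<sigma> * d)) \<le> (1 - h) * exp (- a * (\<sigma> * x))"
    if "1/8 \<le> a" "a \<le> 7/8" for a
  proof -
    have "p * exp (- a * (\<sigma> * u)) + (1 - p) * exp (- a * (\<sigma> * d))
        = (p * (q / p) powr a + (1 - p) * ((1 - q) / (1 - p)) powr a) * exp (- a * (\<sigma> * x))"
    proof -
      have "exp (- a * (\<sigma> * u)) = exp (- a * (\<sigma> * x)) * (q / p) powr a"
        unfolding u_def using pq by (intro e)
      moreover have "exp (- a * (\<sigma> * d)) = exp (- a * (\<sigma> * x)) * ((1 - q) / (1 - p)) powr a"
        unfolding d_def using pq by (intro e) auto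
      ultimately show ?thesis by (simp only: algebra_simps)
    qed
    also have "\<dots> \<le> (1 - h) * exp (- a * (\<sigma> * x))"
      using bernoulli_affinity_le[OF pq that] h by (intro mult_right_mono) auto
    finally show ?thesis .
  qed
  have "p * V u + (1 - p) * V d
      = K * ((p * exp (- a * (\<sigma> * u)) + (1 - p) * exp (- a * (\<sigma> * d)))
           + (p * exp (- b * (\<sigma> * u)) + (1 - p) * exp (- b * (\<sigma> * d))))"
    unfolding V_def by (simp add: algebra_simps)
  also have "\<dots> \<le> K * ((1 - h) * exp (- a * (\<sigma> * x)) + (1 - h) * exp (- b * (\<sigma> * x)))"
    using K ab by (intro mult_left_mono add_mono one) auto
  finally show ?thesis by (simp add: V_def algebra_simps)
qed

text \<open>Covers both states at once: \<open>r\<close> and \<open>r'\<close> belong to the true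
  and the false state, and \<open>B\<close> is meant to hold the pairs of belief and signal that
  cause a mistake.\<close>

lemma (in sequence_space) expected_error_times_finite:
  fixes l :: "'a \<Rightarrow> real" and u d r r' :: "real \<Rightarrow> real" and \<sigma> \<kappa> :: real and B :: "(real \<times> 'a) set"
  assumes l[measurable]: "l \<in> borel_measurable M"
    and u[measurable]: "u \<in> borel_measurable borel" and d[measurable]: "d \<in> borel_measurable borel"
    and \<sigma>: "\<bar>\<sigma>\<bar> = 1"
    and r: "\<And>x. 0 < r x" "\<And>x. r x < 1" "\<And>x. 0 < r' x" "\<And>x. r' x < 1"
    and prob_up: "\<And>x. measure M {s \<in> space M. x + l s > 0} = r x"
    and u_eq: "\<And>x. u x = x + \<sigma> * ln (r x / r' x)"
    and d_eq: "\<And>x. d x = x + \<sigma> * ln ((1 - r x) / (1 - r' x))"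
    and \<kappa>: "\<kappa> > 0" and gap: "\<And>x. \<kappa> * exp (- \<bar>x\<bar> / 8) \<le> (r x - r' x)\<^sup>2"
    and B: "B \<in> sets (borel \<Otimes>\<^sub>M M)"
    and prob_B: "\<And>x. measure M {s \<in> space M. (x, s) \<in> B} \<le> exp (- (\<sigma> * x) / 2)"
  defines "f \<equiv> \<lambda>x s. if x + l s > 0 then u x else d x"
  shows "(\<integral>\<^sup>+ w. (\<Sum>n. of_nat (Suc n) * indicator B (orbit f x n w, w n)) \<partial>S) < \<infinity>"
proof -
  define \<eta> where "\<eta> = \<kappa> / 32"
  have \<eta>: "\<eta> > 0" using \<kappa> by (simp add: \<eta>_def)
  define E where "E a x = exp (- a * (\<sigma> * x))" for a x :: real
  \<comment> \<open>A step costs \<open>U\<close> and \<open>W\<close> at least the fraction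
    \<open>\<eta> * exp (- \<bar>x\<bar> / 8)\<close> of their value. The prefactors are chosen so
    that the loss of \<open>U\<close> covers the mistake bound \<open>E (1/2)\<close> and that of
    \<open>W\<close> covers \<open>U\<close>; the 2 comes from the second part of
    \<open>exp_le_exp_abs_interpolate\<close>.\<close>
  define U where "U x = 1 / \<eta> * (E (1/4) x + E (3/4) x)" for x
  define W where "W x = 2 / \<eta>\<^sup>2 * (E (1/8) x + E (7/8) x)" for x
  have UW_nonneg: "U x \<ge> 0" "W x \<ge> 0" for x
    using \<eta> by (auto simp: U_def W_def E_def intro!: mult_nonneg_nonneg add_nonneg_nonneg)
  have [measurable]: "U \<in> borel_measurable borel" "W \<in> borel_measurable borel"
    unfolding U_def[abs_def] W_def[abs_def] E_def by measurable
  have f_meas: "(\<lambda>(x, s). f x s) \<in> borel \<Otimes>\<^sub>M M \<rightarrow>\<^sub>M borel"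
    unfolding f_def by measurable
  have step: "(\<integral>\<^sup>+ s. ennreal (g (f x s)) \<partial>M) = ennreal (r x * g (u x) + (1 - r x) * g (d x))"
    if g: "\<And>y. g y \<ge> 0" for g x
  proof -
    let ?A = "{s \<in> space M. x + l s > 0}"
    have A[measurable]: "?A \<in> sets M" by measurable
    have "(\<integral>\<^sup>+ s. ennreal (g (f x s)) \<partial>M)
        = (\<integral>\<^sup>+ s. ennreal (g (u x)) * indicator ?A s + ennreal (g (d x)) * indicator (space M - ?A) s \<partial>M)"
      by (intro nn_integral_cong) (auto simp: f_def indicator_def)
    also have "\<dots> = ennreal (g (u x)) * emeasure M ?A + ennreal (g (d x)) * emeasure M (space M - ?A)"
      by (subst nn_integral_add) (auto simp: nn_integral_cmult_indicator)
    also have "\<dots> = ennreal (g (u x)) * ennreal (r x) + ennreal (g (d x)) * ennreal (1 - r x)"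
      using M.prob_compl[OF A] by (simp add: M.emeasure_eq_measure prob_up)
    also have "\<dots> = ennreal (r x * g (u x) + (1 - r x) * g (d x))"
      using g r[of x] by (simp add: ennreal_mult mult.commute)
    finally show ?thesis .
  qed
  have small: "\<eta> * exp (- \<bar>x\<bar> / 8) \<le> (r x - r' x)\<^sup>2 / 32" for x
    using gap[of x] by (simp add: \<eta>_def)
  have UV: "E (1/2) x \<le> \<eta> * exp (- \<bar>x\<bar> / 8) * U x" and WU: "U x \<le> \<eta> * exp (- \<bar>x\<bar> / 8) * W x" for x
  proof -
    have abs: "\<bar>\<sigma> * x\<bar> = \<bar>x\<bar>" using \<sigma> by (simp add: abs_mult)
    have c: "z = exp (- \<bar>x\<bar> / 8) * (exp (\<bar>x\<bar> / 8) * z)" for z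
      by (simp flip: exp_add mult.assoc)
    have "E (1/2) x = exp (- \<bar>x\<bar> / 8) * (exp (\<bar>x\<bar> / 8) * E (1/2) x)"
      by (rule c)
    also have "\<dots> \<le> exp (- \<bar>x\<bar> / 8) * (E (1/4) x + E (3/4) x)"
      using exp_le_exp_abs_interpolate(1)[of "\<sigma> * x"] unfolding abs
      by (intro mult_left_mono) (auto simp: E_def)
    finally show "E (1/2) x \<le> \<eta> * exp (- \<bar>x\<bar> / 8) * U x"
      using \<eta> by (simp add: U_def)
    have "E (1/4) x + E (3/4) x = exp (- \<bar>x\<bar> / 8) * (exp (\<bar>x\<bar> / 8) * (E (1/4) x + E (3/4) x))"
      by (rule c)
    also have "\<dots> \<le> exp (- \<bar>x\<bar> / 8) * (2 * (E (1/8) x + E (7/8) x))"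
      using exp_le_exp_abs_interpolate(2)[of "\<sigma> * x"] unfolding abs
      by (intro mult_left_mono) (auto simp: E_def)
    finally have "1 / \<eta> * (E (1/4) x + E (3/4) x)
        \<le> 1 / \<eta> * (exp (- \<bar>x\<bar> / 8) * (2 * (E (1/8) x + E (7/8) x)))"
      using \<eta> by (intro mult_left_mono) auto
    also have "\<dots> = \<eta> * exp (- \<bar>x\<bar> / 8) * W x"
      using \<eta> by (simp add: W_def power2_eq_square)
    finally show "U x \<le> \<eta> * exp (- \<bar>x\<bar> / 8) * W x" unfolding U_def .
  qed
  have U_drift: "(\<integral>\<^sup>+ s. ennreal (U (f x s)) \<partial>M) + (\<integral>\<^sup>+ s. indicator B (x, s) \<partial>M) \<le> ennreal (U x)" for x
  proof -
    have Bx: "{s \<in> space M. (x, s) \<in> B} \<in> sets M" using B by measurable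
    have "(\<integral>\<^sup>+ s. indicator B (x, s) \<partial>M) = (\<integral>\<^sup>+ s. indicator {s \<in> space M. (x, s) \<in> B} s \<partial>M)"
      by (intro nn_integral_cong) (auto simp: indicator_def)
    also have "\<dots> = ennreal (measure M {s \<in> space M. (x, s) \<in> B})"
      using Bx by (simp add: M.emeasure_eq_measure)
    also have "\<dots> \<le> ennreal (E (1/2) x)"
      using prob_B[of x] by (intro ennreal_leI) (simp add: E_def)
    finally have "(\<integral>\<^sup>+ s. ennreal (U (f x s)) \<partial>M) + (\<integral>\<^sup>+ s. indicator B (x, s) \<partial>M)
        \<le> ennreal (r x * U (u x) + (1 - r x) * U (d x)) + ennreal (E (1/2) x)"
      by (intro add_mono) (simp_all add: step UW_nonneg)
    also have "\<dots> = ennreal (r x * U (u x) + (1 - r x) * U (d x) + E (1/2) x)"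
      using r[of x] UW_nonneg by (subst ennreal_plus) (auto simp: E_def)
    also have "\<dots> \<le> ennreal (U x)"
    proof (intro ennreal_leI)
      have "r x * U (u x) + (1 - r x) * U (d x) \<le> (1 - \<eta> * exp (- \<bar>x\<bar> / 8)) * U x"
        unfolding U_def E_def u_eq d_eq using r \<sigma> \<eta> small by (intro drift_exp_le) auto
      then show "r x * U (u x) + (1 - r x) * U (d x) + E (1/2) x \<le> U x"
        using UV[of x] by (simp add: left_diff_distrib)
    qed
    finally show ?thesis .
  qed
  have W_drift: "(\<integral>\<^sup>+ s. ennreal (W (f x s)) \<partial>M) + ennreal (U x) \<le> ennreal (W x)" for x
  proof -
    have "(\<integral>\<^sup>+ s. ennreal (W (f x s)) \<partial>M) + ennreal (U x)
        = ennreal (r x * W (u x) + (1 - r x) * W (d x) + U x)"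
      using r[of x] UW_nonneg by (subst ennreal_plus) (auto simp: step)
    also have "\<dots> \<le> ennreal (W x)"
    proof (intro ennreal_leI)
      have "r x * W (u x) + (1 - r x) * W (d x) \<le> (1 - \<eta> * exp (- \<bar>x\<bar> / 8)) * W x"
        unfolding W_def E_def u_eq d_eq using r \<sigma> \<eta> small by (intro drift_exp_le) auto
      then show "r x * W (u x) + (1 - r x) * W (d x) + U x \<le> W x"
        using WU[of x] by (simp add: left_diff_distrib)
    qed
    finally show ?thesis .
  qed
  have "(\<integral>\<^sup>+ w. (\<Sum>n. of_nat (Suc n) * indicator B (orbit f x n w, w n)) \<partial>S) \<le> ennreal (W x)"
    by (rule nn_integral_suminf_visit_times_le[where N = borel and U = "\<lambda>x. ennreal (U x)"])
      (use f_meas B U_drift W_drift in auto)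
  also have "\<dots> < \<infinity>" by simp
  finally show ?thesis .
qed

text \<open>Index n stands for agent n + 1. If learning takes a finite time T > 1, agent T - 1 errs
  and contributes T - 1 alone. If mistakes never stop, the terms are unbounded and the sum is
  infinite.\<close>

lemma TL_le_suminf:
  "TL Fp Fm \<theta> w \<le> 1 + (\<Sum>n. of_nat (Suc n) * (if act Fp Fm (Suc n) w \<noteq> \<theta> then 1 else 0))"
    (is "_ \<le> 1 + (\<Sum>n. ?e n)")
proof -
  have term_le: "of_nat (Suc n) \<le> (\<Sum>n. ?e n)" if "act Fp Fm (Suc n) w \<noteq> \<theta>" for n
    using sum_le_suminf[of ?e "{n}"] that by simp
  let ?P = "\<lambda>t. t \<ge> 1 \<and> (\<forall>\<tau>\<ge>t. act Fp Fm \<tau> w = \<theta>)"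
  show ?thesis
  proof (cases "\<exists>t. ?P t")
    case True
    define T where "T = (LEAST t. ?P t)"
    have T: "?P T" unfolding T_def using True by (rule LeastI_ex)
    have TL: "TL Fp Fm \<theta> w = of_nat T"
      using True by (auto simp: TL_def T_def)
    show ?thesis
    proof (cases "T = 1")
      case True
      then show ?thesis by (simp add: TL)
    next
      case False
      with T obtain n where n: "T = Suc (Suc n)"
        by (metis One_nat_def Suc_le_D not_one_le_zero old.nat.exhaust)
      have "\<not> ?P (Suc n)" using not_less_Least[of "Suc n" ?P] n by (simp add: T_def)
      then obtain \<tau> where \<tau>: "\<tau> \<ge> Suc n" "act Fp Fm \<tau> w \<noteq> \<theta>" by auto
      have "\<tau> = Suc n" using T n \<tau> by (metis le_antisym not_less_eq_eq)
      then have "of_nat (Suc n) \<le> (\<Sum>n. ?e n)" using \<tau> by (intro term_le) simp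
      then have "1 + of_nat (Suc n) \<le> 1 + (\<Sum>n. ?e n)" by (rule add_left_mono)
      then show ?thesis by (simp add: TL n)
    qed
  next
    case False
    have "(\<Sum>n. ?e n) = \<infinity>"
    proof (rule ccontr)
      assume "(\<Sum>n. ?e n) \<noteq> \<infinity>"
      then obtain K where K: "(\<Sum>n. ?e n) < of_nat K"
        using ennreal_Ex_less_of_nat by (auto simp: less_top)
      obtain \<tau> where \<tau>: "\<tau> \<ge> Suc K" "act Fp Fm \<tau> w \<noteq> \<theta>" using False by force
      then obtain n where n: "\<tau> = Suc n" "K \<le> n" by (cases \<tau>) auto
      have "(of_nat K :: ennreal) \<le> of_nat (Suc n)" using n by (simp only: of_nat_le_iff)
      also have "\<dots> \<le> (\<Sum>n. ?e n)" using \<tau> n by (intro term_le) simp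
      finally show False using K by simp
    qed
    then show ?thesis by simp
  qed
qed

section \<open>The public belief as a Markov chain\<close>

context binary_signal
begin

abbreviation belief_step :: "real \<Rightarrow> real \<Rightarrow> real" where
  "belief_step x s \<equiv> if x + L s > 0 then x + Dp Fp Fm x else x + Dm Fp Fm x"

text \<open>The chain starts with agent 1, past the dummy value of \<open>ell\<close> at 0, so its
  inputs are the signals from \<open>w 1\<close> on.\<close>

lemma ell_eq_orbit: "ell Fp Fm (Suc n) w = orbit belief_step 0 n (\<lambda>i. w (Suc i))"
  by (induction n) (auto simp: Let_def)

text \<open>\<open>Dp\<close> and \<open>Dm\<close> compare state +1 with state -1, while
  \<open>r\<close> and \<open>r'\<close> compare the true state with the false one; the factor
  \<open>\<theta>\<close> accounts for the inversion of the ratio.\<close>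

lemma nn_integral_TL_finite:
  fixes \<theta> :: int and F :: "real measure" and r r' :: "real \<Rightarrow> real" and \<kappa> :: real
  assumes F: "prob_space F" "sets F = sets borel" and \<theta>: "\<theta> = 1 \<or> \<theta> = -1"
    and r: "\<And>x. 0 < r x" "\<And>x. r x < 1" "\<And>x. 0 < r' x" "\<And>x. r' x < 1"
    and prob_up: "\<And>x. measure F {s. x + L s > 0} = r x"
    and Dp_eq: "\<And>x. Dp Fp Fm x = \<theta> * ln (r x / r' x)"
    and Dm_eq: "\<And>x. Dm Fp Fm x = \<theta> * ln ((1 - r x) / (1 - r' x))"
    and \<kappa>: "\<kappa> > 0" and gap: "\<And>x. \<kappa> * exp (- \<bar>x\<bar> / 8) \<le> (r x - r' x)\<^sup>2"
    and prob_err: "\<And>x :: real. measure F {s. (if x + L s > 0 then 1 else -1) \<noteq> \<theta>} \<le> exp (- (\<theta> * x) / 2)"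
  shows "(\<integral>\<^sup>+ w. TL Fp Fm \<theta> w \<partial>(PiM UNIV (\<lambda>_::nat. F))) < \<infinity>"
proof -
  interpret F: prob_space F by fact
  interpret sequence_space F ..
  note [measurable_cong] = F(2)
  have sp: "space F = UNIV" using sets_eq_imp_space_eq[OF F(2)] by simp
  have [measurable]: "Dp Fp Fm \<in> borel_measurable borel" "Dm Fp Fm \<in> borel_measurable borel"
    unfolding Dp_def[abs_def] Dm_def[abs_def] by measurable
  define B where "B = {z :: real \<times> real. (if fst z + L (snd z) > 0 then 1 else -1) \<noteq> \<theta>}"
  have B: "B \<in> sets (borel \<Otimes>\<^sub>M F)"
  proof -
    have "{z \<in> space (borel \<Otimes>\<^sub>M F). (if fst z + L (snd z) > 0 then 1 else -1) \<noteq> \<theta>} \<in> sets (borel \<Otimes>\<^sub>M F)"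
      by measurable
    then show ?thesis by (simp add: B_def space_pair_measure sp)
  qed
  let ?g = "\<lambda>w. \<Sum>n. of_nat (Suc n) * indicator B (orbit belief_step 0 n w, w n) :: ennreal"
  have [measurable]: "orbit belief_step 0 n \<in> S \<rightarrow>\<^sub>M borel" for n
    by (rule measurable_orbit) (auto simp: split_beta')
  have g[measurable]: "?g \<in> borel_measurable S"
    using B by measurable
  have fin: "(\<integral>\<^sup>+ w. ?g w \<partial>S) < \<infinity>"
    by (rule expected_error_times_finite[OF _ _ _ _ r _ _ _ \<kappa> gap B, where \<sigma> = "of_int \<theta>"])
      (measurable, use \<theta> prob_up Dp_eq Dm_eq prob_err in \<open>auto simp: sp B_def\<close>)
  have "TL Fp Fm \<theta> w \<le> 1 + ?g (\<lambda>i. w (Suc i))" for w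
  proof -
    have "(if act Fp Fm (Suc n) w \<noteq> \<theta> then 1 else 0)
        = (indicator B (orbit belief_step 0 n (\<lambda>i. w (Suc i)), w (Suc n)) :: ennreal)" for n
      by (simp only: act_def ell_eq_orbit B_def) (simp add: indicator_def)
    then show ?thesis using TL_le_suminf[of Fp Fm \<theta> w] by simp
  qed
  then have "(\<integral>\<^sup>+ w. TL Fp Fm \<theta> w \<partial>S) \<le> (\<integral>\<^sup>+ w. 1 + ?g (\<lambda>i. w (Suc i)) \<partial>S)"
    by (intro nn_integral_mono) auto
  also have "\<dots> = (\<integral>\<^sup>+ w. 1 + ?g w \<partial>S)"
    by (rule nn_integral_shift[of "\<lambda>w. 1 + ?g w"]) (intro borel_measurable_add g borel_measurable_const)
  also have "\<dots> = 1 + (\<integral>\<^sup>+ w. ?g w \<partial>S)"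
    using nn_integral_add[OF borel_measurable_const[of 1] g]
    by (simp only: nn_integral_const P.emeasure_space_1 mult_1)
  also have "\<dots> < \<infinity>" using fin by (simp add: less_top)
  finally show ?thesis .
qed

end

theorem theorem6:
  fixes Fp Fm :: "real measure" and c k x0 :: real
  assumes "prob_space Fp" and "prob_space Fm"
    and "sets Fp = sets borel" and "sets Fm = sets borel"
    and "absolutely_continuous Fp Fm" and "absolutely_continuous Fm Fp"
    and "\<forall>M::real. measure Fp {s. privL Fp Fm s > M} + measure Fm {s. privL Fp Fm s > M} > 0
                 \<and> measure Fp {s. privL Fp Fm s < - M} + measure Fm {s. privL Fp Fm s < - M} > 0"
    and "c > 0" and "k > 0" and "x0 > 0"
    and "\<forall>x>x0. Gm Fp Fm (- x) = c * x powr (- k) \<and> Gp Fp Fm x = 1 - c * x powr (- k)"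
  shows "ETL Fp Fm < \<infinity>"
proof -
  interpret binary_signal Fp Fm
    using assms by (simp add: binary_signal_def binary_signal_axioms_def)
  \<comment> \<open>The gap enters squared, so the rate 1/16 yields the required 1/8.\<close>
  obtain K where K: "K > 0" and gap: "\<And>y. K * exp (- (1/16) * \<bar>y\<bar>) \<le> Gm Fp Fm y - Gp Fp Fm y"
    using G_gap_lower_bound[of c k "1/16" x0] assms by auto
  have "0 < K * exp (- (1/16) * \<bar>y\<bar>)" for y using K by simp
  then have "Gp Fp Fm y < Gm Fp Fm y" for y using gap[of y] by (metis diff_gt_0_iff_gt less_le_trans)
  note G = G_pos_less_one[OF this]
  have up: "{s. x + L s > 0} = {s. L s > - x}" for x by auto
  have err_p: "{s. (if x + L s > 0 then 1 else -1 :: int) \<noteq> 1} = {s. L s \<le> - x}"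
    and err_m: "{s. (if x + L s > 0 then 1 else -1 :: int) \<noteq> -1} = {s. L s > - x}" for x by auto
  have sq: "K\<^sup>2 * exp (- \<bar>x\<bar> / 8) \<le> (Gm Fp Fm (- x) - Gp Fp Fm (- x))\<^sup>2" for x
  proof -
    have "K\<^sup>2 * exp (- \<bar>x\<bar> / 8) = (K * exp (- (1/16) * \<bar>- x\<bar>))\<^sup>2"
      by (simp add: power_mult_distrib flip: exp_of_nat_mult)
    also have "\<dots> \<le> (Gm Fp Fm (- x) - Gp Fp Fm (- x))\<^sup>2"
      using K by (intro power_mono gap) auto
    finally show ?thesis .
  qed
  have half: "exp (- x) * a \<le> exp (- x / 2)" if "0 \<le> x" "0 \<le> a" "a \<le> 1" for x a :: real
    using mult_mono[of "exp (- x)" "exp (- x / 2)" a 1] that by simp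
  have "(\<integral>\<^sup>+ w. TL Fp Fm 1 w \<partial>(PiM UNIV (\<lambda>_::nat. Fp))) < \<infinity>"
  proof (rule nn_integral_TL_finite[where \<kappa> = "K\<^sup>2" and r = "\<lambda>x. 1 - Gp Fp Fm (- x)" and r' = "\<lambda>x. 1 - Gm Fp Fm (- x)"])
    fix x
    show "measure Fp {s. (if x + L s > 0 then 1 else -1) \<noteq> (1 :: int)} \<le> exp (- (real_of_int 1 * x) / 2)"
    \<comment> \<open>If the belief favours the truth, the change of measure bounds the mistake
      probability by \<open>exp (- x)\<close>; otherwise the claimed bound is at least 1.\<close>
    proof (cases "x \<ge> 0")
      case True
      then show ?thesis using Gp_le[of "- x"] half[of x "Gm Fp Fm (- x)"] G_Icc(2)[of "- x"]
        unfolding err_p Gp_def[symmetric] by simp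
    next
      case False
      then have "1 \<le> exp (- x / 2)" by simp
      with G_Icc(1)[of "- x"] have "Gp Fp Fm (- x) \<le> exp (- x / 2)" by (auto intro: order_trans)
      then show ?thesis unfolding err_p Gp_def[symmetric] by simp
    qed
  qed (use assms G sq K in \<open>simp_all add: up Dp_def Dm_def flip: Gp_compl\<close>)
  moreover have "(\<integral>\<^sup>+ w. TL Fp Fm (-1) w \<partial>(PiM UNIV (\<lambda>_::nat. Fm))) < \<infinity>"
  \<comment> \<open>Now \<open>Fm\<close> is the true law, so \<open>r\<close> and \<open>r'\<close>
    trade places.\<close>
  proof (rule nn_integral_TL_finite[where \<kappa> = "K\<^sup>2" and r = "\<lambda>x. 1 - Gm Fp Fm (- x)" and r' = "\<lambda>x. 1 - Gp Fp Fm (- x)"])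
    fix x
    show "measure Fm {s. (if x + L s > 0 then 1 else -1) \<noteq> (-1 :: int)} \<le> exp (- (real_of_int (-1) * x) / 2)"
    proof (cases "x \<le> 0")
      case True
      then show ?thesis using Gm_compl_le[of "- x"] half[of "- x" "1 - Gp Fp Fm (- x)"] G_Icc(1)[of "- x"]
        unfolding err_m Gm_compl[symmetric] by simp
    next
      case False
      then have "1 \<le> exp (x / 2)" by simp
      moreover have "1 - Gm Fp Fm (- x) \<le> 1" using G_Icc(2)[of "- x"] by simp
      ultimately have "1 - Gm Fp Fm (- x) \<le> exp (x / 2)" by linarith
      then show ?thesis unfolding err_m Gm_compl[symmetric] by simp
    qed
    show "Dp Fp Fm x = real_of_int (-1) * ln ((1 - Gm Fp Fm (- x)) / (1 - Gp Fp Fm (- x)))"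
      using G[of "- x"] by (simp add: Dp_def ln_div)
    show "Dm Fp Fm x = real_of_int (-1) * ln ((1 - (1 - Gm Fp Fm (- x))) / (1 - (1 - Gp Fp Fm (- x))))"
      using G[of "- x"] by (simp add: Dm_def ln_div)
    show "K\<^sup>2 * exp (- \<bar>x\<bar> / 8) \<le> (1 - Gm Fp Fm (- x) - (1 - Gp Fp Fm (- x)))\<^sup>2"
      using sq[of x] by (simp add: power2_commute)
  qed (use assms G K in \<open>simp_all add: up flip: Gm_compl\<close>)
  moreover have "(1 / 2 :: ennreal) \<noteq> \<top>" by (simp add: ennreal_divide_eq_top_iff)
  ultimately show ?thesis
    unfolding ETL_def by (simp add: ennreal_mult_less_top less_top)
qed

end
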